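(* Let $\varepsilon=\sqrt3/(9\pi)$ and $c(\varepsilon)=1/\sqrt{2\cosh(\varepsilon)-2}$ (so $c(\varepsilon)=16.321642\ldots$). For every irrational $\alpha\in\mathbb{R}/\mathbb{Z}$, the boundary function $$\mathscr{B}_\alpha(r)=\inf_{j\ge1}c(\varepsilon)\sqrt{4\sin^2(\pi j\alpha)\,r^2+j^2}\qquad(r\ge0)$$ (infimum over integers $j\ge1$) satisfies $$\mathscr{B}_\alpha(r)\le1000\sqrt r\qquad\text{whenever } r\ge\sqrt2\,q_7^2,$$ where $q_7$ is the denominator of the seventh rational convergent of $\alpha$.
   Context: Identify $\alpha$ with its representative in $(0,1)$ and write its continued fraction $\alpha=[a_1,a_2,a_3,\ldots]=1/(a_1+1/(a_2+\cdots))$ with integers $a_n\ge1$. The denominators of the convergents are $q_0=1$, $q_1=a_1$, $q_n=a_nq_{n-1}+q_{n-2}$ for $n\ge2$. *)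

theory Defs
  imports "HOL-Analysis.Analysis"
begin

text \<open>
  A class in \<open>\<real>/\<int>\<close> is given by an arbitrary real representative \<open>\<alpha>\<close>. Continued
  fraction data refer to its representative \<open>frac \<alpha>\<close>, which lies in \<open>(0,1)\<close> when
  \<open>\<alpha>\<close> is irrational; \<open>cf_rem \<alpha> n\<close> is the tail \<open>[a\<^sub>n\<^sub>+\<^sub>1, a\<^sub>n\<^sub>+\<^sub>2, \<dots>]\<close>.
\<close>

fun cf_rem :: "real \<Rightarrow> nat \<Rightarrow> real" where
  "cf_rem \<alpha> 0 = frac \<alpha>"
| "cf_rem \<alpha> (Suc n) = frac (1 / cf_rem \<alpha> n)"

text \<open>
  Partial quotients are indexed from 1, so \<open>a\<^sub>n = \<lfloor>1 / cf_rem \<alpha> (n - 1)\<rfloor>\<close> for \<open>n \<ge> 1\<close>;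
  the value at \<open>n = 0\<close> has no meaning and is never used.
\<close>

definition cf_quot :: "real \<Rightarrow> nat \<Rightarrow> int" where
  "cf_quot \<alpha> n = \<lfloor>1 / cf_rem \<alpha> (n - 1)\<rfloor>"

fun cf_denom :: "real \<Rightarrow> nat \<Rightarrow> int" where
  "cf_denom \<alpha> 0 = 1"
| "cf_denom \<alpha> (Suc 0) = cf_quot \<alpha> 1"
| "cf_denom \<alpha> (Suc (Suc n)) =
     cf_quot \<alpha> (n + 2) * cf_denom \<alpha> (Suc n) + cf_denom \<alpha> n"

definition eps :: real where
  "eps = sqrt 3 / (9 * pi)"

definition c_const :: "real \<Rightarrow> real" where
  "c_const \<epsilon> = 1 / sqrt (2 * cosh \<epsilon> - 2)"

definition boundary_fun :: "real \<Rightarrow> real \<Rightarrow> real" where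
  "boundary_fun \<alpha> r =
     (INF j\<in>{1::nat..}.
        c_const eps * sqrt (4 * (sin (pi * real j * \<alpha>))\<^sup>2 * r\<^sup>2 + (real j)\<^sup>2))"

text \<open>
  The remaining facts confirm that the continued fraction algorithm above never
  terminates and unfolds \<open>\<alpha>\<close> as \<open>1 / (a\<^sub>1 + 1 / (a\<^sub>2 + \<dots>))\<close> with all \<open>a\<^sub>n \<ge> 1\<close>, and
  that nothing depends on the chosen representative of the class of \<open>\<alpha>\<close>.
\<close>

lemma cf_rem_irrational:
  assumes "\<alpha> \<notin> \<rat>"
  shows "cf_rem \<alpha> n \<notin> \<rat>"
proof -
  have frac_irr: "frac x \<notin> \<rat>" if "x \<notin> \<rat>" for x :: real
  proof
    assume "frac x \<in> \<rat>"
    then have "frac x + of_int \<lfloor>x\<rfloor> \<in> \<rat>" by (intro Rats_add Rats_of_int)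
    then show False using that by (simp add: frac_def)
  qed
  show ?thesis
  proof (induction n)
    case 0
    then show ?case using frac_irr[OF assms] by simp
  next
    case (Suc n)
    have "1 / cf_rem \<alpha> n \<notin> \<rat>"
    proof
      assume "1 / cf_rem \<alpha> n \<in> \<rat>"
      then have "inverse (1 / cf_rem \<alpha> n) \<in> \<rat>" by (rule Rats_inverse)
      then show False using Suc by simp
    qed
    then show ?case using frac_irr by simp
  qed
qed

lemma cf_rem_bounds:
  assumes "\<alpha> \<notin> \<rat>"
  shows "0 < cf_rem \<alpha> n" "cf_rem \<alpha> n < 1"
proof -
  have "0 \<le> cf_rem \<alpha> n" by (cases n) auto
  moreover have "cf_rem \<alpha> n \<noteq> 0" using cf_rem_irrational[OF assms, of n] by auto
  ultimately show "0 < cf_rem \<alpha> n" by simp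
  show "cf_rem \<alpha> n < 1" by (cases n) (auto simp: frac_lt_1)
qed

lemma cf_quot_ge_1:
  assumes "\<alpha> \<notin> \<rat>"
  shows "1 \<le> cf_quot \<alpha> n"
  using cf_rem_bounds[OF assms, of "n - 1"] by (simp add: cf_quot_def le_floor_iff)

lemma cf_rem_unfold:
  "cf_rem \<alpha> n = 1 / (of_int (cf_quot \<alpha> (Suc n)) + cf_rem \<alpha> (Suc n))"
  by (simp add: cf_quot_def frac_def)

lemma cf_denom_frac: "cf_denom (frac \<alpha>) n = cf_denom \<alpha> n"
proof -
  have "cf_rem (frac \<alpha>) n = cf_rem \<alpha> n" for n by (induction n) auto
  then have "cf_quot (frac \<alpha>) n = cf_quot \<alpha> n" for n by (simp add: cf_quot_def)
  then show ?thesis by (induction \<alpha> n rule: cf_denom.induct) auto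
qed

lemma boundary_fun_frac: "boundary_fun (frac \<alpha>) r = boundary_fun \<alpha> r"
proof -
  have "(sin (pi * real j * frac \<alpha>))\<^sup>2 = (sin (pi * real j * \<alpha>))\<^sup>2" for j :: nat
  proof -
    define m where "m = int j * \<lfloor>\<alpha>\<rfloor>"
    have "pi * real j * frac \<alpha> = pi * real j * \<alpha> - of_int m * pi"
      by (simp add: frac_def m_def algebra_simps)
    moreover have "sin (of_int m * pi) = 0" using sin_zero_iff_int2 by blast
    moreover from this have "(cos (of_int m * pi))\<^sup>2 = 1"
      using sin_cos_squared_add[of "of_int m * pi"] by simp
    ultimately show ?thesis by (simp add: sin_diff power_mult_distrib)
  qed
  then show ?thesis by (simp add: boundary_fun_def)
qed

end

theory Submission
  imports Defs
begin

text \<open>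
  The infimum in the boundary function is controlled by a single good denominator. Dirichlet's
  theorem with cut-off \<open>N = \<lceil>sqrt r\<rceil>\<close> gives some \<open>1 \<le> k \<le> N\<close> for which \<open>k * \<alpha>\<close> lies within \<open>1 / N\<close>
  of an integer. Since \<open>sin\<^sup>2\<close> has period \<open>\<pi>\<close> and \<open>\<bar>sin x\<bar> \<le> \<bar>x\<bar>\<close>, the two terms under the root at
  \<open>j = k\<close> are at most \<open>4 \<pi>\<^sup>2 r\<^sup>2 / N\<^sup>2 \<le> 4 \<pi>\<^sup>2 r\<close> and \<open>N\<^sup>2 \<le> 4 r\<close>, so that, for every \<open>r \<ge> 1\<close>, the
  boundary function is at most \<open>c sqrt ((4 \<pi>\<^sup>2 + 4) r)\<close> (lemma \<open>boundary_fun_le\<close>). As \<open>q\<^sub>7 \<ge> 1\<close>, every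
  \<open>r \<ge> sqrt 2 * q\<^sub>7\<^sup>2\<close> is at least 1, and \<open>c < 17\<close> together with \<open>4 \<pi>\<^sup>2 + 4 \<le> 49\<close> leaves ample room
  below 1000.

  The decimals of \<open>c\<close> are a matter of precision only. The square root in \<open>\<epsilon>\<close> disappears from
  \<open>\<epsilon>\<^sup>2 = 1 / (27 \<pi>\<^sup>2)\<close>, and \<open>2 cosh \<epsilon> - 2\<close> is a power series in \<open>\<epsilon>\<^sup>2\<close>; three of its terms
  (lemma \<open>cosh_Taylor_bounds\<close>) and a dozen digits of \<open>\<pi>\<close> decide all the stated digits.
\<close>

text \<open>
  Adding the Taylor formulas of \<open>exp\<close> at \<open>x\<close> and at \<open>- x\<close> cancels the odd powers; the two
  Lagrange remainders of order 8 are nonnegative, and at most \<open>exp 1 * x ^ 8 / 8!\<close> each.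
\<close>

lemma cosh_Taylor_bounds:
  fixes x :: real
  assumes "\<bar>x\<bar> \<le> 1"
  shows "x^2 + x^4 / 12 + x^6 / 360 \<le> 2 * cosh x - 2"
    and "2 * cosh x - 2 \<le> x^2 + x^4 / 12 + x^6 / 360 + x^8 / 6720"
proof -
  obtain s where s: "\<bar>s\<bar> \<le> \<bar>x\<bar>"
      "exp x = (\<Sum>m<8. x ^ m / fact m) + exp s / fact 8 * x ^ 8"
    using Maclaurin_exp_le[of x 8] by blast
  obtain t where t: "\<bar>t\<bar> \<le> \<bar>- x\<bar>"
      "exp (- x) = (\<Sum>m<8. (- x) ^ m / fact m) + exp t / fact 8 * (- x) ^ 8"
    using Maclaurin_exp_le[of "- x" 8] by blast
  have eq: "2 * cosh x - 2
      = x^2 + x^4 / 12 + x^6 / 360 + (exp s + exp t) * (x ^ 8 / 40320)"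
    unfolding cosh_def s(2) t(2)
    by (simp add: lessThan_nat_numeral fact_numeral field_simps)
  have "exp s \<le> 3" "exp t \<le> 3"
    using s(1) t(1) assms exp_le exp_le_cancel_iff[of s 1] exp_le_cancel_iff[of t 1] by linarith+
  then have "(exp s + exp t) * (x ^ 8 / 40320) \<le> 6 * (x ^ 8 / 40320)"
    by (intro mult_right_mono) auto
  then show "2 * cosh x - 2 \<le> x^2 + x^4 / 12 + x^6 / 360 + x^8 / 6720"
    unfolding eq by simp
  have "0 \<le> (exp s + exp t) * (x ^ 8 / 40320)" by simp
  then show "x^2 + x^4 / 12 + x^6 / 360 \<le> 2 * cosh x - 2"
    unfolding eq by linarith
qed

lemma eps_power2: "eps\<^sup>2 = 1 / (27 * pi\<^sup>2)"
  by (simp add: eps_def power_divide power_mult_distrib)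

lemma eps_power2_bounds: "0.003752636430 \<le> eps\<^sup>2" "eps\<^sup>2 \<le> 0.003752636432"
proof -
  have "3.141592653588\<^sup>2 \<le> pi\<^sup>2" "pi\<^sup>2 \<le> 3.1415926535899\<^sup>2"
    using pi_approx by (intro power_mono; simp)+
  then show "0.003752636430 \<le> eps\<^sup>2" "eps\<^sup>2 \<le> 0.003752636432"
    unfolding eps_power2 by (simp_all add: field_simps power2_eq_square)
qed

text \<open>
  The window \<open>[16.321642, 16.321643)\<close> for \<open>c\<close> is, squared and inverted, a window for
  \<open>2 cosh \<epsilon> - 2\<close>. Its lower end for \<open>c\<close> is the tight one: the true value exceeds it by less than
  one part in \<open>10\<^sup>8\<close>, which is why the Taylor bounds must go as far as \<open>\<epsilon>\<^sup>6\<close>.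
\<close>

lemma c_const_eps_bounds: "16.321642 \<le> c_const eps" "c_const eps < 16.321643"
proof -
  define t where "t = eps\<^sup>2"
  define A where "A = 2 * cosh eps - 2"
  have t: "0.003752636430 \<le> t" "t \<le> 0.003752636432"
    using eps_power2_bounds by (simp_all add: t_def)
  have "\<bar>eps\<bar> \<le> 1"
    using t by (simp flip: abs_square_le_1 add: t_def)
  note Taylor = cosh_Taylor_bounds[OF this]
  have powers: "eps^4 = t^2" "eps^6 = t^3" "eps^8 = t^4"
    by (simp_all add: t_def flip: power_mult)
  have A: "t + t^2 / 12 + t^3 / 360 \<le> A"
      "A \<le> t + t^2 / 12 + t^3 / 360 + t^4 / 6720"
    using Taylor by (simp_all only: powers A_def t_def)
  have "0.003752636430 + 0.003752636430^2 / 12 + 0.003752636430^3 / 360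
      \<le> t + t^2 / 12 + t^3 / 360"
    using t by (intro add_mono divide_right_mono power_mono) auto
  with A(1) have low: "(1 / 16.321643)\<^sup>2 < A"
    by (simp add: power2_eq_square power3_eq_cube)
  have "t + t^2 / 12 + t^3 / 360 + t^4 / 6720
      \<le> 0.003752636432 + 0.003752636432^2 / 12 + 0.003752636432^3 / 360
        + 0.003752636432^4 / 6720"
    using t by (intro add_mono divide_right_mono power_mono) auto
  with A(2) have upp: "A \<le> (1 / 16.321642)\<^sup>2"
    by (simp add: power2_eq_square power3_eq_cube power4_eq_xxxx)
  have "1 / 16.321643 < sqrt A"
    using low by (rule real_less_rsqrt)
  moreover have "sqrt A \<le> 1 / 16.321642"
    using upp by (intro real_le_lsqrt) auto
  moreover have "0 < sqrt A"
    using \<open>1 / 16.321643 < sqrt A\<close> by (rule order.strict_trans[rotated]) simp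
  ultimately have "16.321642 \<le> 1 / sqrt A" "1 / sqrt A < 16.321643"
    by (simp_all add: field_simps)
  then show "16.321642 \<le> c_const eps" "c_const eps < 16.321643"
    unfolding c_const_def A_def .
qed

text \<open>
  Subtracting an integer multiple of \<open>\<pi>\<close> from the argument of the sine changes only its sign;
  the integer \<open>h\<close> of interest is the one close to \<open>x\<close>.
\<close>

lemma sin_pi_power2_le:
  fixes x :: real and h :: int
  shows "(sin (pi * x))\<^sup>2 \<le> (pi * (x - of_int h))\<^sup>2"
proof -
  have cos1: "(cos (pi * of_int h))\<^sup>2 = 1"
    using sin_cos_squared_add[of "pi * of_int h"] by simp
  have "sin (pi * (x - of_int h)) = sin (pi * x) * cos (pi * of_int h)"
    by (simp add: right_diff_distrib sin_diff)
  then have "(sin (pi * x))\<^sup>2 = (sin (pi * (x - of_int h)))\<^sup>2"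
    by (simp add: power_mult_distrib cos1)
  also have "\<dots> \<le> (pi * (x - of_int h))\<^sup>2"
    using abs_sin_x_le_abs_x by (simp add: abs_le_square_iff)
  finally show ?thesis .
qed

lemma boundary_fun_le:
  assumes "1 \<le> r"
  shows "boundary_fun \<alpha> r \<le> c_const eps * sqrt ((4 * pi\<^sup>2 + 4) * r)"
proof -
  define N where "N = nat \<lceil>sqrt r\<rceil>"
  have "1 \<le> sqrt r" using assms by simp
  then have N: "sqrt r \<le> real N" "real N \<le> 2 * sqrt r" "0 < N"
    unfolding N_def by linarith+
  have "(sqrt r)\<^sup>2 \<le> (real N)\<^sup>2" "(real N)\<^sup>2 \<le> (2 * sqrt r)\<^sup>2"
    using N assms by (intro power_mono; simp)+
  then have N2: "r \<le> (real N)\<^sup>2" "(real N)\<^sup>2 \<le> 4 * r"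
    using assms by (simp_all add: power_mult_distrib)
  obtain h k where k: "0 < k" "k \<le> int N" "\<bar>of_int k * \<alpha> - of_int h\<bar> < 1 / N"
    using Dirichlet_approx[OF \<open>0 < N\<close>, of \<alpha>] by blast
  define j where "j = nat k"
  have j: "1 \<le> j" "j \<le> N" "of_int k = real j"
    using k by (auto simp: j_def)
  define d where "d = real j * \<alpha> - of_int h"
  have "\<bar>d\<bar> \<le> 1 / N" using k(3) by (simp add: d_def j(3))
  then have "d\<^sup>2 \<le> (1 / N)\<^sup>2"
    by (metis abs_ge_zero power2_abs power_mono)
  also have "\<dots> \<le> 1 / r"
    using N2 assms by (simp add: power_divide frac_le)
  finally have "d\<^sup>2 * r\<^sup>2 \<le> (1 / r) * r\<^sup>2"
    by (rule mult_right_mono) simp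
  then have dr: "d\<^sup>2 * r\<^sup>2 \<le> r"
    using assms by (simp add: power2_eq_square)
  have "4 * (sin (pi * real j * \<alpha>))\<^sup>2 * r\<^sup>2 \<le> 4 * (pi * d)\<^sup>2 * r\<^sup>2"
    using sin_pi_power2_le[of "real j * \<alpha>" h]
    by (intro mult_right_mono mult_left_mono) (simp_all add: d_def mult.assoc)
  also have "\<dots> = 4 * pi\<^sup>2 * (d\<^sup>2 * r\<^sup>2)"
    by (simp add: power_mult_distrib)
  also have "\<dots> \<le> 4 * pi\<^sup>2 * r"
    using dr by (intro mult_left_mono) auto
  finally have sin_le: "4 * (sin (pi * real j * \<alpha>))\<^sup>2 * r\<^sup>2 \<le> 4 * pi\<^sup>2 * r" .
  have "(real j)\<^sup>2 \<le> (real N)\<^sup>2"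
    using j by (intro power_mono) auto
  then have root_le: "4 * (sin (pi * real j * \<alpha>))\<^sup>2 * r\<^sup>2 + (real j)\<^sup>2 \<le> (4 * pi\<^sup>2 + 4) * r"
    unfolding distrib_right using sin_le N2(2) by linarith
  have c0: "0 \<le> c_const eps"
    by (rule order_trans[OF _ c_const_eps_bounds(1)]) simp
  have "boundary_fun \<alpha> r
      \<le> c_const eps * sqrt (4 * (sin (pi * real j * \<alpha>))\<^sup>2 * r\<^sup>2 + (real j)\<^sup>2)"
    unfolding boundary_fun_def
  proof (rule cINF_lower)
    show "bdd_below ((\<lambda>j. c_const eps * sqrt (4 * (sin (pi * real j * \<alpha>))\<^sup>2 * r\<^sup>2 + (real j)\<^sup>2))
        ` {1::nat..})"
      using c0 by (intro bdd_belowI2[where m = 0]) auto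
  qed (use j in simp)
  also have "\<dots> \<le> c_const eps * sqrt ((4 * pi\<^sup>2 + 4) * r)"
    using root_le c0 by (intro mult_left_mono real_sqrt_le_mono)
  finally show ?thesis .
qed

lemma cf_denom_ge_1:
  assumes "\<alpha> \<notin> \<rat>"
  shows "1 \<le> cf_denom \<alpha> n"
  using assms
proof (induction \<alpha> n rule: cf_denom.induct)
  case (3 \<alpha> n)
  then have "0 \<le> cf_quot \<alpha> (n + 2) * cf_denom \<alpha> (Suc n)"
    using cf_quot_ge_1[of \<alpha> "n + 2"] by (intro mult_nonneg_nonneg) auto
  with 3 show ?case by simp
qed (auto simp: cf_quot_ge_1)

theorem corollary4p8:
  shows "16.321642 \<le> c_const eps \<and> c_const eps < 16.321643 \<and>
    (\<forall>\<alpha>::real. \<alpha> \<notin> \<rat> \<longrightarrow>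
      (\<forall>r::real. r \<ge> sqrt 2 * (of_int (cf_denom \<alpha> 7))\<^sup>2 \<longrightarrow>
        boundary_fun \<alpha> r \<le> 1000 * sqrt r))"
proof (intro conjI allI impI c_const_eps_bounds)
  fix \<alpha> r :: real
  assume irr: "\<alpha> \<notin> \<rat>" and r: "r \<ge> sqrt 2 * (of_int (cf_denom \<alpha> 7))\<^sup>2"
  have "(1::real) \<le> of_int (cf_denom \<alpha> 7)"
    using cf_denom_ge_1[OF irr, of 7] by simp
  then have "1 * 1 \<le> sqrt 2 * (of_int (cf_denom \<alpha> 7))\<^sup>2"
    by (intro mult_mono one_le_power) auto
  with r have r1: "1 \<le> r" by simp
  have "pi\<^sup>2 \<le> 3.1415926535899\<^sup>2"
    using pi_approx by (intro power_mono) auto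
  then have "4 * pi\<^sup>2 + 4 \<le> 7\<^sup>2"
    by (simp add: power2_eq_square)
  then have "sqrt ((4 * pi\<^sup>2 + 4) * r) \<le> sqrt (7\<^sup>2 * r)"
    using r1 by (intro real_sqrt_le_mono mult_right_mono) auto
  also have "\<dots> = 7 * sqrt r"
    by (simp add: real_sqrt_mult)
  finally have "c_const eps * sqrt ((4 * pi\<^sup>2 + 4) * r) \<le> 17 * (7 * sqrt r)"
    using c_const_eps_bounds r1 by (intro mult_mono) auto
  also have "\<dots> \<le> 1000 * sqrt r"
    using r1 by simp
  finally show "boundary_fun \<alpha> r \<le> 1000 * sqrt r"
    using boundary_fun_le[OF r1, of \<alpha>] by linarith
qed

end
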